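(* Let $n\ge1$ and let a sequence $(\psi_k)$ of functions in $\mathcal T_n$ converge in $\mathcal T_n$ to a function $\psi$, that is, $\psi$ is a function defined on $(-\infty,0)^n$ and $\psi_k\to\psi$ pointwise on $(-\infty,0)^n$. Then: (1) $\psi\in\mathcal T_n$; (2) the sequence $(\psi_k)$ converges to $\psi$ uniformly on compact subsets of the domain $\{z\in\mathbb C^n:\operatorname{Re}z_j<0,\ j=1,\dots,n\}$; (3) for every $\theta\in(0,\pi)$, the sequence $(\psi_k)$ is uniformly bounded on compact subsets of the cone $S_\theta^n$.
   Context: A function in $C^\infty((-\infty,0)^n)$ is called absolutely monotone if it is nonnegative together with all its partial derivatives of all orders. $\mathcal T_n$ is the class of all nonpositive functions in $C^\infty((-\infty,0)^n)$ all of whose first-order partial derivatives are absolutely monotone. Every $\psi\in\mathcal T_n$ has a representation $$\psi(z)=c_0+c_1\cdot z+\int_{\mathbb R_+^n\setminus\{0\}}(e^{z\cdot u}-1)\,d\mu(u)$$ for $z\in(-\infty,0)^n$, with $c_0=\lim_{s\to-0}\psi(s)\le0$, $c_1\in\mathbb R_+^n$ and $\mu$ a positive Radon measure on $\mathbb R_+^n\setminus\{0\}$ (where $\mathbb R_+=[0,\infty)$, $a\cdot b=\sum_i a_ib_i$, and $s\to-0$ means every $s_i$ tends to $0$ from the left) such that, for small $\delta>0$, the functions $u\mapsto u_j$ are $\mu$-integrable on $[0,\delta)^n\setminus\{0\}$ and $\mu(\mathbb R_+^n\setminus[0,\delta)^n)<\infty$. By this formula $\psi$ is extended to a function holomorphic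 in $\{z\in\mathbb C^n:\operatorname{Re}z_j<0,\ j=1,\dots,n\}$ and continuous on its closure; the extended function is still denoted $\psi$ and regarded as an element of $\mathcal T_n$. In (2) and (3) the functions are understood as so extended. $S_\theta$ denotes the closure of the sector $\{\zeta\in\mathbb C:\frac{\pi}{2}+\frac{\theta}{2}<\arg\zeta<\frac{3\pi}{2}-\frac{\theta}{2}\}$, and $S_\theta^n$ is its $n$-fold Cartesian power. *)

theory Defs
  imports "HOL-Analysis.Analysis"
begin

definition neg_orthant :: "(real ^ 'n) set" where
  "neg_orthant = {x. \<forall>j. x $ j < 0}"

text \<open>Partial derivatives; at a point of an open set these depend only on the values of the
  function on that set, so functions on \<^const>\<open>neg_orthant\<close> are represented by total functions
  whose values elsewhere are irrelevant.\<close>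

definition partial_deriv :: "'n \<Rightarrow> (real ^ 'n \<Rightarrow> real) \<Rightarrow> real ^ 'n \<Rightarrow> real" where
  "partial_deriv j f x = deriv (\<lambda>t. f (x + t *\<^sub>R axis j 1)) 0"

primrec partial_derivs :: "'n list \<Rightarrow> (real ^ 'n \<Rightarrow> real) \<Rightarrow> real ^ 'n \<Rightarrow> real" where
  "partial_derivs [] f = f"
| "partial_derivs (j # js) f = partial_deriv j (partial_derivs js f)"

definition C_infinity_on :: "(real ^ 'n) set \<Rightarrow> (real ^ 'n \<Rightarrow> real) \<Rightarrow> bool" where
  "C_infinity_on U f \<longleftrightarrow>
     (\<forall>js. continuous_on U (partial_derivs js f) \<and>
       (\<forall>j. \<forall>x\<in>U. (\<lambda>t. partial_derivs js f (x + t *\<^sub>R axis j 1)) field_differentiable (at 0)))"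

definition absolutely_monotone :: "(real ^ 'n \<Rightarrow> real) \<Rightarrow> bool" where
  "absolutely_monotone f \<longleftrightarrow>
     C_infinity_on neg_orthant f \<and> (\<forall>js. \<forall>x\<in>neg_orthant. 0 \<le> partial_derivs js f x)"

definition class_T :: "(real ^ 'n \<Rightarrow> real) set" where
  "class_T = {\<psi>. C_infinity_on neg_orthant \<psi> \<and> (\<forall>x\<in>neg_orthant. \<psi> x \<le> 0) \<and>
                  (\<forall>j. absolutely_monotone (partial_deriv j \<psi>))}"

definition nonneg_orthant :: "(real ^ 'n) set" where
  "nonneg_orthant = {u. \<forall>j. 0 \<le> u $ j}"

definition corner_cube :: "real \<Rightarrow> (real ^ 'n) set" where
  "corner_cube \<delta> = {u. \<forall>j. 0 \<le> u $ j \<and> u $ j < \<delta>}"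

text \<open>The Radon measures on the locally compact Polish space \<open>nonneg_orthant - {0}\<close> are the
  Borel measures that are finite on compact sets, inner regularity being automatic there.\<close>

definition levy_measure :: "(real ^ 'n) measure \<Rightarrow> bool" where
  "levy_measure \<mu> \<longleftrightarrow>
     sets \<mu> = sets (restrict_space borel (nonneg_orthant - {0})) \<and>
     (\<forall>K. compact K \<and> K \<subseteq> nonneg_orthant - {0} \<longrightarrow> emeasure \<mu> K < \<infinity>) \<and>
     (\<forall>\<^sub>F \<delta> in at_right 0.
        (\<forall>j. set_integrable \<mu> (corner_cube \<delta> - {0}) (\<lambda>u. u $ j)) \<and>
        emeasure \<mu> (nonneg_orthant - corner_cube \<delta>) < \<infinity>)"

definition represents ::
    "real \<Rightarrow> real ^ 'n \<Rightarrow> (real ^ 'n) measure \<Rightarrow> (real ^ 'n \<Rightarrow> real) \<Rightarrow> bool" where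
  "represents c\<^sub>0 c\<^sub>1 \<mu> \<psi> \<longleftrightarrow>
     c\<^sub>0 \<le> 0 \<and> (\<psi> \<longlongrightarrow> c\<^sub>0) (at 0 within neg_orthant) \<and>
     c\<^sub>1 \<in> nonneg_orthant \<and> levy_measure \<mu> \<and>
     (\<forall>x\<in>neg_orthant. \<psi> x = c\<^sub>0 + c\<^sub>1 \<bullet> x + (\<integral>u. (exp (x \<bullet> u) - 1) \<partial>\<mu>))"

text \<open>Bilinear, without conjugation; this is not the inner product of \<open>complex ^ 'n\<close>.\<close>

definition cdot :: "complex ^ 'n \<Rightarrow> real ^ 'n \<Rightarrow> complex" where
  "cdot z u = (\<Sum>j\<in>UNIV. z $ j * complex_of_real (u $ j))"

definition left_tube :: "(complex ^ 'n) set" where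
  "left_tube = {z. \<forall>j. Re (z $ j) < 0}"

text \<open>\<open>\<Psi>\<close> extends \<open>\<psi>\<close> to the closed tube by the integral formula.  Values of \<open>\<Psi>\<close> outside the
  closed tube are irrelevant.\<close>

definition extends_by_formula ::
    "(real ^ 'n \<Rightarrow> real) \<Rightarrow> (complex ^ 'n \<Rightarrow> complex) \<Rightarrow> bool" where
  "extends_by_formula \<psi> \<Psi> \<longleftrightarrow>
     (\<exists>c\<^sub>0 c\<^sub>1 \<mu>. represents c\<^sub>0 c\<^sub>1 \<mu> \<psi> \<and>
        (\<forall>z\<in>closure left_tube.
           \<Psi> z = complex_of_real c\<^sub>0 + cdot z c\<^sub>1 + (\<integral>u. (exp (cdot z u) - 1) \<partial>\<mu>)))"

definition sector :: "real \<Rightarrow> complex set" where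
  "sector \<theta> = closure {\<zeta>. pi / 2 + \<theta> / 2 < Arg2pi \<zeta> \<and> Arg2pi \<zeta> < 3 * pi / 2 - \<theta> / 2}"

definition sector_power :: "real \<Rightarrow> (complex ^ 'n) set" where
  "sector_power \<theta> = {z. \<forall>j. z $ j \<in> sector \<theta>}"

end

theory Submission
  imports Defs "HOL-Complex_Analysis.Great_Picard"
begin

text \<open>
  Two facts carry the proof.

  The class is closed under pointwise limits because all partial derivatives of order at least one
  are nonnegative, hence increasing in every variable.  In one variable, the second derivative at
  \<open>t\<close> is therefore bounded by a difference quotient of the function further to the right
  (\<open>second_derivative_bound\<close>), and such quotients converge along the sequence.  Bounded second
  derivatives let the limit be exchanged with the first derivative
  (\<open>derivative_of_pointwise_limit\<close>), and by induction on the order all partial derivatives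
  converge to those of the limit and keep their sign.  Continuity of the limits again follows from
  monotonicity (\<open>continuous_on_neg_orthant_if_partials_mono\<close>).

  For the extended functions, everything is controlled by one number. If \<open>\<psi>\<close> is
  represented by \<open>c\<^sub>0\<close>, \<open>c\<^sub>1\<close> and \<open>\<mu>\<close>, then
  \<open>- \<psi> (- 1)\<close>, at the vector with all coordinates \<open>- 1\<close>, is the sum
  of \<open>\<bar>c\<^sub>0\<bar>\<close>, the coordinates of \<open>c\<^sub>1\<close> and the
  integral of \<open>1 - exp (- s)\<close>, where \<open>s\<close> is the sum of the coordinates of
  \<open>u\<close>. The integrands \<open>exp (cdot z u) - 1\<close>, their differences and their
  second-order remainders are dominated by multiples of \<open>1 - exp (- s)\<close>. So \<open>-
  \<psi> (- 1)\<close>, which is bounded along the sequence, bounds the extension on bounded subsets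
  of the closed tube (\<open>extension_bound\<close>), which contains the cones of the theorem, and
  bounds its Lipschitz constant at a positive distance from the boundary
  (\<open>extension_Lipschitz\<close>). Pointwise convergence on the tube follows from convergence
  on the real orthant by Vitali's theorem on complex lines
  (\<open>extension_pointwise_limit\<close>); together with the common Lipschitz constant it is
  uniform on compact sets.
\<close>

section \<open>Exponential bounds\<close>

lemma min_1_le_one_minus_exp:
  fixes s :: real
  assumes "0 \<le> s"
  shows "min 1 s \<le> 2 * (1 - exp (- s))"
proof -
  have "exp (- s) \<le> 1 / (1 + s)"
    using exp_ge_add_one_self[of s] assms by (simp add: exp_minus field_simps)
  then have "2 * (1 - 1 / (1 + s)) \<le> 2 * (1 - exp (- s))"
    by simp
  moreover have "min 1 s \<le> 2 * (1 - 1 / (1 + s))"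
    using assms by (cases "s \<le> 1") (auto simp: field_simps mult_left_le)
  ultimately show ?thesis by (rule order_trans[rotated])
qed

lemma exp_Lipschitz_half_plane:
  assumes "Re v \<le> a" "Re w \<le> a"
  shows "norm (exp v - exp w) \<le> exp a * norm (v - w)"
proof (rule field_differentiable_bound[where S = "{z. Re z \<le> a}" and f' = exp])
  show "convex {z. Re z \<le> a}" by (rule convex_halfspace_Re_le)
  show "(exp has_field_derivative exp z) (at z within {z. Re z \<le> a})" for z
    by (rule DERIV_subset[OF DERIV_exp]) simp
qed (use assms in auto)

text \<open>The right-hand side of this and the next two estimates is a multiple of \<open>1 - exp (- s)\<close>
  because, at \<open>s = (\<Sum>j\<in>UNIV. u $ j)\<close>, the integral of that function is one of the summands of
  \<open>- \<psi> (- 1)\<close>.\<close>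

lemma norm_exp_minus_1_le:
  assumes "0 \<le> s" "Re w \<le> 0" "norm w \<le> R * s" "0 \<le> R"
  shows "norm (exp w - 1) \<le> 2 * (2 + R) * (1 - exp (- s))"
proof -
  have "exp (Re w) \<le> 1"
    using assms by simp
  then have 1: "norm (exp w - 1) \<le> 2"
    using norm_triangle_ineq4[of "exp w" 1] unfolding norm_exp_eq_Re norm_one by linarith
  have 2: "norm (exp w - 1) \<le> R * s"
    using exp_Lipschitz_half_plane[of w 0 0] assms by auto
  have "norm (exp w - 1) \<le> (2 + R) * min 1 s"
    using 1 2 assms by (cases "s \<le> 1") (auto simp: min_def algebra_simps intro: add_increasing)
  also have "\<dots> \<le> (2 + R) * (2 * (1 - exp (- s)))"
    using min_1_le_one_minus_exp[of s] assms by (intro mult_left_mono) auto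
  finally show ?thesis by (simp only: mult_ac)
qed

lemma mult_exp_minus_le:
  fixes s e :: real
  assumes "0 \<le> s" "0 < e"
  shows "s * exp (- (e * s)) \<le> 2 * (1 + 1 / e) * (1 - exp (- s))"
proof -
  have "e * s \<le> exp (e * s)"
    using exp_ge_add_one_self[of "e * s"] by linarith
  then have 1: "s * exp (- (e * s)) \<le> 1 / e"
    using assms by (simp add: exp_minus field_simps)
  have 2: "s * exp (- (e * s)) \<le> s"
    using assms by (simp add: mult_left_le)
  have "s * exp (- (e * s)) \<le> (1 + 1 / e) * min 1 s"
  proof (cases "s \<le> 1")
    case True
    then have "s \<le> (1 + 1 / e) * min 1 s"
      using assms by (simp add: field_simps)
    then show ?thesis using 2 by linarith
  next
    case False
    then show ?thesis using 1 assms by simp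
  qed
  also have "\<dots> \<le> (1 + 1 / e) * (2 * (1 - exp (- s)))"
    using min_1_le_one_minus_exp[of s] assms by (intro mult_left_mono) auto
  finally show ?thesis by (simp only: mult_ac)
qed

lemma square_mult_exp_minus_le:
  fixes s e :: real
  assumes "0 \<le> s" "0 < e"
  shows "s\<^sup>2 * exp (- (e * s)) \<le> 2 * (1 + 2 / e\<^sup>2) * (1 - exp (- s))"
proof -
  have "(e * s)\<^sup>2 / 2 \<le> exp (e * s)"
    using exp_lower_Taylor_quadratic[of "e * s"] mult_nonneg_nonneg[of e s] assms by linarith
  then have "s\<^sup>2 / exp (e * s) \<le> 2 / e\<^sup>2"
    using assms by (simp add: field_simps power2_eq_square)
  then have 1: "s\<^sup>2 * exp (- (e * s)) \<le> 2 / e\<^sup>2"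
    by (simp add: exp_minus field_simps)
  have 2: "s\<^sup>2 * exp (- (e * s)) \<le> s\<^sup>2"
    using assms by (simp add: mult_left_le)
  have "s\<^sup>2 * exp (- (e * s)) \<le> (1 + 2 / e\<^sup>2) * min 1 s"
  proof (cases "s \<le> 1")
    case True
    then have "s\<^sup>2 \<le> s" using assms by (simp add: power2_eq_square mult_left_le)
    moreover have "s \<le> (1 + 2 / e\<^sup>2) * min 1 s"
      using True assms by (simp add: field_simps)
    ultimately show ?thesis using 2 by linarith
  next
    case False
    then show ?thesis using 1 by simp
  qed
  also have "\<dots> \<le> (1 + 2 / e\<^sup>2) * (2 * (1 - exp (- s)))"
    using min_1_le_one_minus_exp[of s] assms by (intro mult_left_mono) auto
  finally show ?thesis by (simp only: mult_ac)
qed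

section \<open>The pairing of complex vectors with the orthant\<close>

definition coord_sum :: "real ^ 'n \<Rightarrow> real" where
  "coord_sum u = (\<Sum>j\<in>UNIV. u $ j)"

lemma coord_sum_nonneg: "u \<in> nonneg_orthant \<Longrightarrow> 0 \<le> coord_sum u"
  by (auto simp: coord_sum_def nonneg_orthant_def intro: sum_nonneg)

lemma cdot_add: "cdot (z + w) u = cdot z u + cdot w u"
  by (simp add: cdot_def sum.distrib algebra_simps)

lemma cdot_diff: "cdot (z - w) u = cdot z u - cdot w u"
  by (simp add: cdot_def sum_subtractf algebra_simps)

lemma cdot_scale: "cdot (c *s z) u = c * cdot z u"
  by (simp add: cdot_def sum_distrib_left mult_ac)

lemma continuous_on_cdot [continuous_intros]: "continuous_on A (\<lambda>u. cdot z u)"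
  unfolding cdot_def by (intro continuous_intros)

lemma cdot_of_real: "cdot (\<chi> j. complex_of_real (x $ j)) u = complex_of_real (x \<bullet> u)"
  by (simp add: cdot_def inner_vec_def)

lemma Re_cdot_le:
  assumes "u \<in> nonneg_orthant" "\<And>j. Re (z $ j) \<le> a"
  shows "Re (cdot z u) \<le> a * coord_sum u"
  using assms unfolding cdot_def nonneg_orthant_def coord_sum_def
  by (auto simp: sum_distrib_left intro!: sum_mono mult_right_mono)

lemma norm_cdot_le:
  assumes "u \<in> nonneg_orthant" "norm z \<le> R"
  shows "norm (cdot z u) \<le> R * coord_sum u"
proof -
  have "norm (z $ j) \<le> R" for j
    using Finite_Cartesian_Product.norm_nth_le[of z j] assms(2) by linarith
  then show ?thesis
    using assms(1) unfolding cdot_def nonneg_orthant_def coord_sum_def sum_distrib_left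
    by (intro sum_norm_le) (auto simp: norm_mult intro!: mult_right_mono)
qed

lemma closure_left_tube: "closure left_tube = {z :: complex ^ 'n. \<forall>j. Re (z $ j) \<le> 0}"
proof
  have "closed {z :: complex ^ 'n. \<forall>j. Re (z $ j) \<le> 0}"
    by (intro closed_Collect_all closed_Collect_le continuous_intros)
  then show "closure left_tube \<subseteq> {z :: complex ^ 'n. \<forall>j. Re (z $ j) \<le> 0}"
    by (intro closure_minimal) (auto simp: left_tube_def less_imp_le)
next
  show "{z :: complex ^ 'n. \<forall>j. Re (z $ j) \<le> 0} \<subseteq> closure left_tube"
  proof
    fix z :: "complex ^ 'n"
    assume z: "z \<in> {z. \<forall>j. Re (z $ j) \<le> 0}"
    define w where "w = (\<lambda>n. z - (\<chi> j. complex_of_real (inverse (real (Suc n)))))"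
    have "w n \<in> left_tube" for n
      using z by (auto simp: w_def left_tube_def intro: le_less_trans)
    moreover have "w \<longlonglongrightarrow> z - (\<chi> j. complex_of_real 0)"
      unfolding w_def by (intro tendsto_intros LIMSEQ_inverse_real_of_nat)
    moreover have "z - (\<chi> j. complex_of_real 0) = z"
      by (simp add: vec_eq_iff)
    ultimately show "z \<in> closure left_tube"
      unfolding closure_sequential by metis
  qed
qed

lemma left_tube_subset_closure: "z \<in> left_tube \<Longrightarrow> z \<in> closure left_tube"
  using closure_subset by blast

lemma sector_Re_le_0:
  assumes "0 < \<theta>" "\<zeta> \<in> sector \<theta>"
  shows "Re \<zeta> \<le> 0"
proof -
  have "{\<zeta>. pi / 2 + \<theta> / 2 < Arg2pi \<zeta> \<and> Arg2pi \<zeta> < 3 * pi / 2 - \<theta> / 2} \<subseteq> {\<zeta>. Re \<zeta> \<le> 0}"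
  proof clarify
    fix \<zeta> assume *: "pi / 2 + \<theta> / 2 < Arg2pi \<zeta>" "Arg2pi \<zeta> < 3 * pi / 2 - \<theta> / 2"
    have "0 < cos (Arg2pi \<zeta> - pi)"
      using * assms by (intro cos_gt_zero_pi) (auto simp: field_simps)
    then have "cos (Arg2pi \<zeta>) < 0" by simp
    then show "Re \<zeta> \<le> 0"
      unfolding cos_Arg2pi[symmetric] by (simp add: mult_nonneg_nonpos)
  qed
  then have "sector \<theta> \<subseteq> {\<zeta>. Re \<zeta> \<le> 0}"
    unfolding sector_def by (rule closure_minimal) (rule closed_halfspace_Re_le)
  then show ?thesis using assms by auto
qed

lemma sector_power_subset: "0 < \<theta> \<Longrightarrow> sector_power \<theta> \<subseteq> closure left_tube"
  using sector_Re_le_0 by (auto simp: sector_power_def closure_left_tube)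

section \<open>Integration against the representing measure\<close>

lemma space_levy_measure:
  assumes "levy_measure \<mu>"
  shows "space \<mu> = nonneg_orthant - {0}"
proof -
  have "sets \<mu> = sets (restrict_space borel (nonneg_orthant - {0}))"
    using assms by (simp add: levy_measure_def)
  from sets_eq_imp_space_eq[OF this] show ?thesis
    by (simp add: space_restrict_space)
qed

lemma continuous_imp_measurable_levy:
  fixes f :: "real ^ 'n \<Rightarrow> 'b :: topological_space"
  assumes "levy_measure \<mu>" "continuous_on UNIV f"
  shows "f \<in> borel_measurable \<mu>"
proof -
  have "f \<in> borel_measurable (restrict_space borel (nonneg_orthant - {0}))"
    by (intro measurable_restrict_space1 borel_measurable_continuous_onI assms)
  moreover have "sets \<mu> = sets (restrict_space borel (nonneg_orthant - {0}))"
    using assms by (simp add: levy_measure_def)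
  ultimately show ?thesis
    using measurable_cong_sets by blast
qed

text \<open>Near \<open>0\<close> the integrand is at most the sum of the coordinates, and elsewhere at most \<open>1\<close>; both
  bounds are integrable by the conditions on the measure at \<open>0\<close> and away from it.\<close>

lemma integrable_one_minus_exp:
  assumes "levy_measure \<mu>"
  shows "integrable \<mu> (\<lambda>u. 1 - exp (- coord_sum u))"
proof -
  obtain \<delta> where \<delta>: "0 < \<delta>"
    and int: "\<And>j. set_integrable \<mu> (corner_cube \<delta> - {0}) (\<lambda>u. u $ j)"
    and fin: "emeasure \<mu> (nonneg_orthant - corner_cube \<delta>) < \<infinity>"
    using assms unfolding levy_measure_def eventually_at_right_field
    by (metis dense)
  have "closed (nonneg_orthant - corner_cube \<delta> :: (real ^ 'a) set)"
  proof -
    have "nonneg_orthant - corner_cube \<delta> =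
        {u :: real ^ 'a. \<forall>j. 0 \<le> u $ j} \<inter> (\<Union>j. {u. \<delta> \<le> u $ j})"
      by (force simp: nonneg_orthant_def corner_cube_def not_less set_eq_iff)
    moreover have "closed (\<Union>j. {u :: real ^ 'a. \<delta> \<le> u $ j})"
      by (intro closed_UN ballI closed_Collect_le continuous_intros) simp
    moreover have "closed {u :: real ^ 'a. \<forall>j. 0 \<le> u $ j}"
      by (intro closed_Collect_all closed_Collect_le continuous_intros)
    ultimately show ?thesis by (metis closed_Int)
  qed
  moreover have "nonneg_orthant - corner_cube \<delta> \<subseteq> nonneg_orthant - {0 :: real ^ 'a}"
    using \<delta> by (auto simp: corner_cube_def)
  ultimately have "nonneg_orthant - corner_cube \<delta> \<in> sets (restrict_space borel (nonneg_orthant - {0 :: real ^ 'a}))"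
    unfolding sets_restrict_space image_iff
    by (intro bexI[of _ "nonneg_orthant - corner_cube \<delta>"]) (auto intro: borel_closed)
  then have "nonneg_orthant - corner_cube \<delta> \<in> sets \<mu>"
    using assms by (simp add: levy_measure_def)
  then have "integrable \<mu> (indicator (nonneg_orthant - corner_cube \<delta>) :: _ \<Rightarrow> real)"
    using fin by (intro integrable_real_indicator) auto
  then have dom: "integrable \<mu> (\<lambda>u. (\<Sum>j\<in>UNIV. indicator (corner_cube \<delta> - {0}) u *\<^sub>R u $ j) +
      indicator (nonneg_orthant - corner_cube \<delta>) u)"
    using int unfolding set_integrable_def by (intro Bochner_Integration.integrable_add Bochner_Integration.integrable_sum) auto
  show ?thesis
  proof (rule Bochner_Integration.integrable_bound[OF dom], goal_cases)
    case 1
    show ?case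
      unfolding coord_sum_def by (intro continuous_imp_measurable_levy[OF assms] continuous_intros)
  next
    case 2
    show ?case
    proof (rule AE_I2)
      fix u assume "u \<in> space \<mu>"
      then have u: "u \<in> nonneg_orthant" "u \<noteq> 0"
        using space_levy_measure[OF assms] by auto
      have s: "0 \<le> coord_sum u" using u coord_sum_nonneg by blast
      have "1 - exp (- coord_sum u) \<le> coord_sum u"
        using exp_ge_add_one_self[of "- coord_sum u"] by linarith
      then have "norm (1 - exp (- coord_sum u)) \<le> (\<Sum>j\<in>UNIV. indicator (corner_cube \<delta> - {0}) u *\<^sub>R u $ j) +
          indicator (nonneg_orthant - corner_cube \<delta>) u"
        using s u by (cases "u \<in> corner_cube \<delta>") (auto simp: coord_sum_def)
      then show "norm (1 - exp (- coord_sum u)) \<le> norm ((\<Sum>j\<in>UNIV. indicator (corner_cube \<delta> - {0}) u *\<^sub>R u $ j) +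
          indicator (nonneg_orthant - corner_cube \<delta>) u)"
        by simp
    qed
  qed
qed

lemma levy_integral_bound:
  fixes f :: "real ^ 'n \<Rightarrow> 'b :: {banach, second_countable_topology}"
  assumes \<mu>: "levy_measure \<mu>" and cont: "continuous_on UNIV f"
    and bound: "\<And>u. u \<in> nonneg_orthant \<Longrightarrow> norm (f u) \<le> C * (1 - exp (- coord_sum u))"
  shows "integrable \<mu> f"
    and "norm (\<integral>u. f u \<partial>\<mu>) \<le> C * (\<integral>u. 1 - exp (- coord_sum u) \<partial>\<mu>)"
proof -
  have dom: "integrable \<mu> (\<lambda>u. C * (1 - exp (- coord_sum u)))"
    using integrable_one_minus_exp[OF \<mu>] by simp
  show int: "integrable \<mu> f"
  proof (rule Bochner_Integration.integrable_bound[OF dom])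
    show "f \<in> borel_measurable \<mu>"
      by (rule continuous_imp_measurable_levy[OF \<mu> cont])
    show "AE u in \<mu>. norm (f u) \<le> norm (C * (1 - exp (- coord_sum u)))"
      by (rule AE_I2) (use bound space_levy_measure[OF \<mu>] in force)
  qed
  have "norm (\<integral>u. f u \<partial>\<mu>) \<le> (\<integral>u. C * (1 - exp (- coord_sum u)) \<partial>\<mu>)"
    by (rule Bochner_Integration.integral_norm_bound_integral[OF int dom])
       (use bound space_levy_measure[OF \<mu>] in auto)
  then show "norm (\<integral>u. f u \<partial>\<mu>) \<le> C * (\<integral>u. 1 - exp (- coord_sum u) \<partial>\<mu>)"
    by simp
qed

section \<open>Bounds for the extended functions\<close>

lemma neg_1_in_neg_orthant: "- 1 \<in> neg_orthant"
  by (simp add: neg_orthant_def)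

lemma inner_neg_1: "(- 1) \<bullet> u = - coord_sum u"
  by (simp add: inner_vec_def coord_sum_def sum_negf)

text \<open>All three summands are nonnegative, so the single number \<open>- \<psi> (- 1)\<close> controls the whole
  representing triple.\<close>

lemma represents_at_neg_1:
  assumes "represents c\<^sub>0 c\<^sub>1 \<mu> \<psi>"
  shows "- \<psi> (- 1) = \<bar>c\<^sub>0\<bar> + coord_sum c\<^sub>1 + (\<integral>u. 1 - exp (- coord_sum u) \<partial>\<mu>)"
proof -
  have "\<psi> (- 1) = c\<^sub>0 + c\<^sub>1 \<bullet> (- 1) + (\<integral>u. exp ((- 1) \<bullet> u) - 1 \<partial>\<mu>)"
    using assms neg_1_in_neg_orthant unfolding represents_def by blast
  moreover have "(\<integral>u. exp ((- 1) \<bullet> u) - 1 \<partial>\<mu>) = - (\<integral>u. 1 - exp (- coord_sum u) \<partial>\<mu>)"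
    unfolding inner_neg_1 Bochner_Integration.integral_minus[symmetric]
    by (rule Bochner_Integration.integral_cong) auto
  ultimately show ?thesis
    using assms inner_neg_1[of c\<^sub>1] by (simp add: represents_def inner_commute[of c\<^sub>1])
qed

lemma levy_integral_cexp:
  fixes z :: "complex ^ 'n"
  assumes "levy_measure \<mu>" "z \<in> closure left_tube" "norm z \<le> R"
  shows "integrable \<mu> (\<lambda>u. exp (cdot z u) - 1)"
    and "norm (\<integral>u. (exp (cdot z u) - 1) \<partial>\<mu>) \<le> 2 * (2 + R) * (\<integral>u. 1 - exp (- coord_sum u) \<partial>\<mu>)"
proof -
  have cont: "continuous_on UNIV (\<lambda>u. exp (cdot z u) - 1)"
    by (intro continuous_intros)
  have bound: "norm (exp (cdot z u) - 1) \<le> 2 * (2 + R) * (1 - exp (- coord_sum u))"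
    if "u \<in> nonneg_orthant" for u
  proof (rule norm_exp_minus_1_le)
    show "Re (cdot z u) \<le> 0"
      using Re_cdot_le[of u z 0] that assms by (simp add: closure_left_tube)
    show "0 \<le> R" using assms(3) norm_ge_zero order_trans by blast
  qed (use that assms coord_sum_nonneg norm_cdot_le in auto)
  show "integrable \<mu> (\<lambda>u. exp (cdot z u) - 1)"
    and "norm (\<integral>u. (exp (cdot z u) - 1) \<partial>\<mu>) \<le> 2 * (2 + R) * (\<integral>u. 1 - exp (- coord_sum u) \<partial>\<mu>)"
    by (rule levy_integral_bound[OF assms(1) cont bound], assumption)+
qed

text \<open>The factor \<open>2 * (2 + R)\<close> comes from the integral term, and it also majorizes the factors \<open>1\<close>
  and \<open>R\<close> that the constant and the linear term require.\<close>

lemma extension_bound: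
  assumes "extends_by_formula \<psi> \<Psi>" "z \<in> closure left_tube" "norm z \<le> R"
  shows "norm (\<Psi> z) \<le> 2 * (2 + R) * (- \<psi> (- 1))"
proof -
  obtain c0 c1 \<mu> where rep: "represents c0 c1 \<mu> \<psi>"
    and \<Psi>: "\<Psi> z = complex_of_real c0 + cdot z c1 + (\<integral>u. (exp (cdot z u) - 1) \<partial>\<mu>)"
    using assms unfolding extends_by_formula_def by blast
  have *: "levy_measure \<mu>" "c1 \<in> nonneg_orthant"
    using rep by (auto simp: represents_def)
  have R: "0 \<le> R" using assms(3) norm_ge_zero order_trans by blast
  have "norm (\<Psi> z) \<le> \<bar>c0\<bar> + norm (cdot z c1) + norm (\<integral>u. (exp (cdot z u) - 1) \<partial>\<mu>)"
    unfolding \<Psi> by (intro norm_triangle_mono) auto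
  also have "\<dots> \<le> 2 * (2 + R) * \<bar>c0\<bar> + 2 * (2 + R) * coord_sum c1 +
      2 * (2 + R) * (\<integral>u. 1 - exp (- coord_sum u) \<partial>\<mu>)"
  proof (intro add_mono)
    show "\<bar>c0\<bar> \<le> 2 * (2 + R) * \<bar>c0\<bar>"
      using mult_right_mono[of 1 "2 * (2 + R)" "\<bar>c0\<bar>"] R by simp
    have "norm (cdot z c1) \<le> R * coord_sum c1"
      using * assms by (simp add: norm_cdot_le)
    also have "\<dots> \<le> 2 * (2 + R) * coord_sum c1"
      using R * by (intro mult_right_mono coord_sum_nonneg) auto
    finally show "norm (cdot z c1) \<le> 2 * (2 + R) * coord_sum c1" .
    show "norm (\<integral>u. (exp (cdot z u) - 1) \<partial>\<mu>) \<le> 2 * (2 + R) * (\<integral>u. 1 - exp (- coord_sum u) \<partial>\<mu>)"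
      by (rule levy_integral_cexp) (use * assms in auto)
  qed
  also have "\<dots> = 2 * (2 + R) * (- \<psi> (- 1))"
    unfolding represents_at_neg_1[OF rep] by (simp add: algebra_simps)
  finally show ?thesis .
qed

text \<open>The decay of \<open>exp (cdot z u)\<close> away from the boundary of the tube compensates the linear growth
  of \<open>cdot (z - w) u\<close>, at the price of a constant that blows up as \<open>e\<close> tends to \<open>0\<close>.\<close>

lemma extension_Lipschitz:
  assumes ext: "extends_by_formula \<psi> \<Psi>" and e: "0 < e"
    and z: "\<And>j. Re (z $ j) \<le> - e" and w: "\<And>j. Re (w $ j) \<le> - e"
  shows "norm (\<Psi> z - \<Psi> w) \<le> 2 * (1 + 1 / e) * (- \<psi> (- 1)) * norm (z - w)"
proof -
  have zw: "z \<in> closure left_tube" "w \<in> closure left_tube"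
    unfolding closure_left_tube using e order_trans[OF z, of 0] order_trans[OF w, of 0] by simp_all
  obtain c0 c1 \<mu> where rep: "represents c0 c1 \<mu> \<psi>"
    and \<Psi>: "\<And>z. z \<in> closure left_tube \<Longrightarrow>
      \<Psi> z = complex_of_real c0 + cdot z c1 + (\<integral>u. (exp (cdot z u) - 1) \<partial>\<mu>)"
    using ext unfolding extends_by_formula_def by blast
  have *: "levy_measure \<mu>" "c1 \<in> nonneg_orthant"
    using rep by (auto simp: represents_def)
  have "\<Psi> z - \<Psi> w = cdot (z - w) c1 +
      ((\<integral>u. (exp (cdot z u) - 1) \<partial>\<mu>) - (\<integral>u. (exp (cdot w u) - 1) \<partial>\<mu>))"
    using \<Psi>[OF zw(1)] \<Psi>[OF zw(2)] by (simp add: cdot_diff)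
  also have "(\<integral>u. (exp (cdot z u) - 1) \<partial>\<mu>) - (\<integral>u. (exp (cdot w u) - 1) \<partial>\<mu>) =
      (\<integral>u. (exp (cdot z u) - 1) - (exp (cdot w u) - 1) \<partial>\<mu>)"
    by (rule Bochner_Integration.integral_diff[symmetric])
       (use * zw levy_integral_cexp(1) order_refl in blast)+
  also have "\<dots> = (\<integral>u. exp (cdot z u) - exp (cdot w u) \<partial>\<mu>)"
    by simp
  finally have "norm (\<Psi> z - \<Psi> w) \<le> norm (cdot (z - w) c1) + norm (\<integral>u. exp (cdot z u) - exp (cdot w u) \<partial>\<mu>)"
    by (simp add: norm_triangle_ineq)
  also have "\<dots> \<le> (2 * (1 + 1 / e) * norm (z - w)) * coord_sum c1 +
      (2 * (1 + 1 / e) * norm (z - w)) * (\<integral>u. 1 - exp (- coord_sum u) \<partial>\<mu>)"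
  proof (intro add_mono)
    have "norm (cdot (z - w) c1) \<le> norm (z - w) * coord_sum c1"
      using * by (simp add: norm_cdot_le)
    also have "\<dots> \<le> (2 * (1 + 1 / e) * norm (z - w)) * coord_sum c1"
    proof (intro mult_right_mono coord_sum_nonneg)
      have "1 * norm (z - w) \<le> (2 * (1 + 1 / e)) * norm (z - w)"
        using e by (intro mult_right_mono) (auto intro: add_increasing2)
      then show "norm (z - w) \<le> 2 * (1 + 1 / e) * norm (z - w)" by simp
    qed (use * in auto)
    finally show "norm (cdot (z - w) c1) \<le> (2 * (1 + 1 / e) * norm (z - w)) * coord_sum c1" .
    have bound: "norm (exp (cdot z u) - exp (cdot w u)) \<le>
        (2 * (1 + 1 / e) * norm (z - w)) * (1 - exp (- coord_sum u))"
      if u: "u \<in> nonneg_orthant" for u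
    proof -
      have "norm (exp (cdot z u) - exp (cdot w u)) \<le>
          exp (- (e * coord_sum u)) * norm (cdot z u - cdot w u)"
        using Re_cdot_le[OF u, of z "- e"] Re_cdot_le[OF u, of w "- e"] z w
        by (intro exp_Lipschitz_half_plane) (auto simp: coord_sum_def)
      also have "\<dots> \<le> exp (- (e * coord_sum u)) * (norm (z - w) * coord_sum u)"
        using norm_cdot_le[OF u order_refl, of "z - w"]
        by (intro mult_left_mono) (auto simp: cdot_diff)
      also have "\<dots> = norm (z - w) * (coord_sum u * exp (- (e * coord_sum u)))"
        by simp
      also have "\<dots> \<le> norm (z - w) * (2 * (1 + 1 / e) * (1 - exp (- coord_sum u)))"
        using u e by (intro mult_left_mono mult_exp_minus_le coord_sum_nonneg) auto
      finally show ?thesis by (simp only: mult_ac)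
    qed
    show "norm (\<integral>u. exp (cdot z u) - exp (cdot w u) \<partial>\<mu>) \<le>
        (2 * (1 + 1 / e) * norm (z - w)) * (\<integral>u. 1 - exp (- coord_sum u) \<partial>\<mu>)"
      by (rule levy_integral_bound(2)[OF *(1) _ bound]) (auto intro!: continuous_intros)
  qed
  also have "\<dots> \<le> (2 * (1 + 1 / e) * norm (z - w)) * (- \<psi> (- 1))"
    unfolding represents_at_neg_1[OF rep] distrib_left using e by simp
  finally show ?thesis by (simp only: mult_ac)
qed

text \<open>Differentiation under the integral sign: the second-order remainder of the exponential is
  integrable because \<open>s\<^sup>2 * exp (- (e * s))\<close> is dominated by \<open>1 - exp (- s)\<close>.\<close>

lemma extension_differentiable_along_line:
  assumes ext: "extends_by_formula \<psi> \<Psi>" and z: "z \<in> left_tube"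
  shows "(\<lambda>h. \<Psi> (z + h *s b)) field_differentiable (at 0)"
proof -
  obtain c0 c1 \<mu> where rep: "represents c0 c1 \<mu> \<psi>"
    and \<Psi>: "\<And>z. z \<in> closure left_tube \<Longrightarrow>
      \<Psi> z = complex_of_real c0 + cdot z c1 + (\<integral>u. (exp (cdot z u) - 1) \<partial>\<mu>)"
    using ext unfolding extends_by_formula_def by blast
  have \<mu>: "levy_measure \<mu>" using rep by (auto simp: represents_def)
  define e where "e = Min (range (\<lambda>j. - Re (z $ j)))"
  have e: "0 < e" "Re (z $ j) \<le> - e" for j
  proof -
    show "0 < e" using z by (auto simp: e_def left_tube_def)
    have "e \<le> - Re (z $ j)" unfolding e_def by (rule Min_le) auto
    then show "Re (z $ j) \<le> - e" by linarith
  qed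
  define J where "J = (\<integral>u. 1 - exp (- coord_sum u) \<partial>\<mu>)"
  define D where "D = cdot b c1 + (\<integral>u. cdot b u * exp (cdot z u) \<partial>\<mu>)"
  have int_D: "integrable \<mu> (\<lambda>u. cdot b u * exp (cdot z u))"
  proof (rule levy_integral_bound(1)[OF \<mu>])
    fix u :: "real ^ 'a" assume u: "u \<in> nonneg_orthant"
    have "norm (cdot b u * exp (cdot z u)) \<le> (norm b * coord_sum u) * exp (- (e * coord_sum u))"
      unfolding norm_mult norm_exp_eq_Re
      using Re_cdot_le[OF u, of z "- e"] e u coord_sum_nonneg[OF u]
      by (intro mult_mono norm_cdot_le) (auto simp: coord_sum_def)
    also have "\<dots> \<le> norm b * (2 * (1 + 1 / e) * (1 - exp (- coord_sum u)))"
      unfolding mult.assoc[of "norm b"]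
      by (rule mult_left_mono[OF mult_exp_minus_le]) (use e u coord_sum_nonneg in auto)
    finally show "norm (cdot b u * exp (cdot z u)) \<le> (norm b * (2 * (1 + 1 / e))) * (1 - exp (- coord_sum u))"
      by (simp only: mult_ac)
  qed (intro continuous_intros)
  \<comment> \<open>For \<open>norm h < \<eta>\<close> the increment uses up at most half of the distance \<open>e\<close> to the boundary; the
    other half of the exponential decay absorbs the factor \<open>s\<^sup>2\<close>.\<close>
  define \<eta> where "\<eta> = e / (2 * (norm b + 1))"
  have \<eta>: "0 < \<eta>" "\<eta> * norm b \<le> e / 2"
    using e by (auto simp: \<eta>_def field_simps add_pos_nonneg add_nonneg_pos)
  define C where "C = (norm b)\<^sup>2 * (2 * (1 + 2 / (e / 2)\<^sup>2))"
  have quad: "norm (\<Psi> (z + h *s b) - \<Psi> z - h * D) \<le> C * J * (norm h)\<^sup>2" if h: "norm h < \<eta>" for h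
  proof -
    have hb: "norm h * norm b \<le> e / 2"
      using h \<eta> by (meson less_imp_le mult_right_mono norm_ge_zero order_trans)
    have nhb: "norm (h *s b) \<le> norm h * norm b"
      unfolding norm_vec_def by (simp add: norm_mult L2_set_right_distrib)
    have zh: "z + h *s b \<in> closure left_tube"
    proof -
      have "Re ((z + h *s b) $ j) \<le> 0" for j
      proof -
        have "Re ((z + h *s b) $ j) \<le> Re (z $ j) + norm ((h *s b) $ j)"
          using complex_Re_le_cmod[of "(h *s b) $ j"] by simp
        also have "norm ((h *s b) $ j) \<le> e / 2"
          using Finite_Cartesian_Product.norm_nth_le[of "h *s b" j] nhb hb by linarith
        finally show ?thesis using e(1) e(2)[of j] by linarith
      qed
      then show ?thesis by (simp add: closure_left_tube)
    qed
    have zc: "z \<in> closure left_tube"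
      using z by (rule left_tube_subset_closure)
    have "\<Psi> (z + h *s b) - \<Psi> z - h * D = 
        (\<integral>u. (exp (cdot (z + h *s b) u) - 1) \<partial>\<mu>) - (\<integral>u. (exp (cdot z u) - 1) \<partial>\<mu>) -
        (\<integral>u. h * (cdot b u * exp (cdot z u)) \<partial>\<mu>)"
      unfolding \<Psi>[OF zh] \<Psi>[OF zc] D_def by (simp add: cdot_add cdot_scale algebra_simps)
    also have "\<dots> = (\<integral>u. (exp (cdot (z + h *s b) u) - 1) - (exp (cdot z u) - 1) -
        h * (cdot b u * exp (cdot z u)) \<partial>\<mu>)"
      using levy_integral_cexp(1)[OF \<mu> zh order_refl] levy_integral_cexp(1)[OF \<mu> zc order_refl] int_D
      by (simp only: Bochner_Integration.integral_diff Bochner_Integration.integrable_diff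
          integrable_mult_right)
    also have "\<dots> = (\<integral>u. exp (cdot z u) * (exp (h * cdot b u) - 1 - h * cdot b u) \<partial>\<mu>)"
      by (simp add: cdot_add cdot_scale exp_add algebra_simps)
    also have "norm \<dots> \<le> C * (norm h)\<^sup>2 * J"
      unfolding J_def
    proof (rule levy_integral_bound(2)[OF \<mu>])
      fix u :: "real ^ 'a" assume u: "u \<in> nonneg_orthant"
      define s where "s = coord_sum u"
      have s: "0 \<le> s" unfolding s_def by (rule coord_sum_nonneg[OF u])
      have w: "norm (h * cdot b u) \<le> norm h * norm b * s"
        using mult_left_mono[OF norm_cdot_le[OF u order_refl, of b], of "norm h"]
        by (simp add: norm_mult s_def mult_ac)
      have "norm (h * cdot b u) \<le> (e / 2) * s"
        using w mult_right_mono[OF hb s] by linarith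
      then have Re: "\<bar>Re (h * cdot b u)\<bar> \<le> (e / 2) * s"
        using abs_Re_le_cmod order_trans by blast
      have "norm (exp (h * cdot b u) - 1 - h * cdot b u) \<le>
          exp \<bar>Re (h * cdot b u)\<bar> * (norm (h * cdot b u))\<^sup>2"
        using Taylor_exp[of "h * cdot b u" 1] by (simp add: algebra_simps power2_eq_square)
      also have "\<dots> \<le> exp ((e / 2) * s) * (norm h * norm b * s)\<^sup>2"
        using Re w by (intro mult_mono power_mono) auto
      finally have "norm (exp (cdot z u) * (exp (h * cdot b u) - 1 - h * cdot b u)) \<le>
          exp (- (e * s)) * (exp ((e / 2) * s) * (norm h * norm b * s)\<^sup>2)"
        unfolding norm_mult norm_exp_eq_Re using Re_cdot_le[OF u, of z "- e"] e
        by (intro mult_mono) (auto simp: coord_sum_def s_def)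
      also have "\<dots> = (exp (- (e * s)) * exp ((e / 2) * s)) * (norm h * norm b * s)\<^sup>2"
        by (simp only: mult_ac)
      also have "exp (- (e * s)) * exp ((e / 2) * s) = exp (- ((e / 2) * s))"
        unfolding mult_exp_exp by (simp add: field_simps)
      also have "exp (- ((e / 2) * s)) * (norm h * norm b * s)\<^sup>2 =
          (norm h)\<^sup>2 * (norm b)\<^sup>2 * (s\<^sup>2 * exp (- ((e / 2) * s)))"
        by (simp add: power_mult_distrib)
      also have "\<dots> \<le> (norm h)\<^sup>2 * (norm b)\<^sup>2 * (2 * (1 + 2 / (e / 2)\<^sup>2) * (1 - exp (- s)))"
        using s e by (intro mult_left_mono square_mult_exp_minus_le) auto
      finally show "norm (exp (cdot z u) * (exp (h * cdot b u) - 1 - h * cdot b u)) \<le>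
          C * (norm h)\<^sup>2 * (1 - exp (- coord_sum u))"
        unfolding C_def s_def by (simp only: mult_ac)
    qed (intro continuous_intros)
    finally show ?thesis by (simp add: mult_ac)
  qed
  have "((\<lambda>h. \<Psi> (z + h *s b)) has_field_derivative D) (at 0)"
    unfolding has_field_derivative_iff
  proof (rule LIM_zero_cancel, rule Lim_null_comparison)
    have "\<forall>\<^sub>F h in at 0. norm h < \<eta> \<and> h \<noteq> 0"
      using \<eta>(1) by (auto simp: eventually_at dist_norm)
    then show "\<forall>\<^sub>F h in at 0. norm ((\<Psi> (z + h *s b) - \<Psi> (z + 0 *s b)) / (h - 0) - D) \<le> C * J * norm h"
    proof eventually_elim
      case (elim h)
      have "(\<Psi> (z + h *s b) - \<Psi> (z + 0 *s b)) / (h - 0) - D = (\<Psi> (z + h *s b) - \<Psi> z - h * D) / h"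
        using elim by (simp add: field_simps)
      also have "norm \<dots> \<le> (C * J * (norm h)\<^sup>2) / norm h"
        unfolding norm_divide using elim by (intro divide_right_mono quad) auto
      finally show ?case using elim by (simp add: power2_eq_square)
    qed
    show "((\<lambda>h. C * J * norm h) \<longlongrightarrow> 0) (at 0)"
      by (auto intro!: tendsto_eq_intros)
  qed
  then show ?thesis
    unfolding field_differentiable_def by blast
qed

section \<open>Uniform convergence\<close>

text \<open>Vitali's theorem: by Montel every subsequence has a locally uniformly convergent subsequence,
  and by the identity theorem its limit does not depend on the choice.\<close>

lemma Vitali_pointwise:
  fixes F :: "nat \<Rightarrow> complex \<Rightarrow> complex"
  assumes S: "open S" "connected S" and hol: "\<And>k. F k holomorphic_on S" "G holomorphic_on S"
    and bounded: "\<And>K. compact K \<Longrightarrow> K \<subseteq> S \<Longrightarrow> \<exists>B. \<forall>k. \<forall>z\<in>K. norm (F k z) \<le> B"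
    and U: "U \<subseteq> S" "\<xi> \<in> S" "\<xi> islimpt U" and lim: "\<And>z. z \<in> U \<Longrightarrow> (\<lambda>k. F k z) \<longlonglongrightarrow> G z"
    and w: "w \<in> S"
  shows "(\<lambda>k. F k w) \<longlonglongrightarrow> G w"
proof (rule ccontr)
  assume "\<not> (\<lambda>k. F k w) \<longlonglongrightarrow> G w"
  then obtain e where "0 < e" and "\<not> (\<forall>\<^sub>F k in sequentially. dist (F k w) (G w) < e)"
    unfolding tendsto_iff by blast
  then have "\<exists>\<^sub>F k in sequentially. e \<le> dist (F k w) (G w)"
    by (simp add: frequently_def not_le)
  then have inf: "infinite {k. e \<le> dist (F k w) (G w)}"
    by (simp add: frequently_cofinite flip: cofinite_eq_sequentially)
  define q where "q = enumerate {k. e \<le> dist (F k w) (G w)}"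
  have q: "strict_mono q" "\<And>k. e \<le> dist (F (q k) w) (G w)"
    unfolding q_def using strict_mono_enumerate[OF inf] enumerate_in_set[OF inf] by auto
  obtain g r where g: "g holomorphic_on S" and r: "strict_mono (r :: nat \<Rightarrow> nat)"
    and gr: "\<And>z. z \<in> S \<Longrightarrow> (\<lambda>n. (F \<circ> q) (r n) z) \<longlonglongrightarrow> g z"
  proof (rule Montel[of S "range (F \<circ> q)" "F \<circ> q"])
    show "\<exists>B. \<forall>h\<in>range (F \<circ> q). \<forall>z\<in>K. norm (h z) \<le> B" if "compact K" "K \<subseteq> S" for K
      using bounded[OF that] by auto
  qed (use S hol in auto)
  have "g w - G w = 0"
  proof (rule analytic_continuation[of "\<lambda>z. g z - G z" S U \<xi>])
    fix z assume z: "z \<in> U"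
    have "(\<lambda>n. F ((q \<circ> r) n) z) \<longlonglongrightarrow> G z"
      using LIMSEQ_subseq_LIMSEQ[OF lim[OF z] strict_mono_o[OF q(1) r]] by (simp add: o_def)
    moreover have "(\<lambda>n. F ((q \<circ> r) n) z) \<longlonglongrightarrow> g z"
      using gr[of z] z U by auto
    ultimately show "g z - G z = 0"
      using LIMSEQ_unique by force
  qed (use S U w g hol in \<open>auto intro: holomorphic_intros\<close>)
  then have "(\<lambda>n. F (q (r n)) w) \<longlonglongrightarrow> G w"
    using gr[OF w] by simp
  then have "\<forall>\<^sub>F n in sequentially. dist (F (q (r n)) w) (G w) < e"
    using \<open>0 < e\<close> by (simp add: tendsto_iff)
  then have "\<exists>n. dist (F (q (r n)) w) (G w) < e"
    by (rule eventually_happens'[rotated]) simp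
  then show False
    using q(2) by (meson not_le)
qed

lemma uniform_limit_equi_Lipschitz:
  fixes F :: "nat \<Rightarrow> 'a :: metric_space \<Rightarrow> 'b :: metric_space"
  assumes "compact K" and F: "\<And>k z w. z \<in> K \<Longrightarrow> w \<in> K \<Longrightarrow> dist (F k z) (F k w) \<le> C * dist z w"
    and lim: "\<And>z. z \<in> K \<Longrightarrow> (\<lambda>k. F k z) \<longlonglongrightarrow> G z"
  shows "uniform_limit K F G sequentially"
proof (rule uniform_limitI)
  fix e :: real assume e: "0 < e"
  have G: "dist (G z) (G w) \<le> C * dist z w" if "z \<in> K" "w \<in> K" for z w
    by (rule LIMSEQ_le_const2[OF tendsto_dist[OF lim[OF that(1)] lim[OF that(2)]]]) (use F that in auto)
  define P where "P = \<bar>C\<bar> + 1"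
  define d where "d = e / (3 * P)"
  have P: "0 < P" "C < P" by (auto simp: P_def)
  have d: "0 < d" "C * d < e / 3"
  proof -
    show "0 < d" using e P by (simp add: d_def)
    then have "C * d < P * d" using P by simp
    also have "P * d = e / 3" using P by (simp add: d_def)
    finally show "C * d < e / 3" .
  qed
  obtain N where N: "finite N" "N \<subseteq> K" "K \<subseteq> (\<Union>z\<in>N. ball z d)"
    by (rule compactE_image[OF \<open>compact K\<close>, of K "\<lambda>z. ball z d"]) (use d(1) in auto)
  have "\<forall>\<^sub>F k in sequentially. \<forall>z\<in>N. dist (F k z) (G z) < e / 3"
  proof (intro eventually_ball_finite ballI)
    fix z assume "z \<in> N"
    then show "\<forall>\<^sub>F k in sequentially. dist (F k z) (G z) < e / 3"
      using tendstoD[OF lim, of z "e / 3"] N e by auto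
  qed (rule N)
  then show "\<forall>\<^sub>F k in sequentially. \<forall>z\<in>K. dist (F k z) (G z) < e"
  proof eventually_elim
    case (elim k)
    show ?case
    proof
      fix w assume w: "w \<in> K"
      then obtain z where z: "z \<in> N" "dist z w < d" using N by auto
      have "C * dist z w < e / 3"
      proof (cases "0 \<le> C")
        case True
        then have "C * dist z w \<le> C * d" using z by (intro mult_left_mono) auto
        then show ?thesis using d by linarith
      next
        case False
        then show ?thesis using e by (simp add: mult_nonpos_nonneg order_le_less_trans[of _ 0])
      qed
      moreover have "dist (F k z) (F k w) \<le> C * dist z w" "dist (G z) (G w) \<le> C * dist z w"
        using F G z N w by auto
      moreover have "dist (F k z) (G z) < e / 3" using elim z by auto
      ultimately show "dist (F k w) (G w) < e"
        using dist_triangle[of "F k w" "G w" "F k z"] dist_triangle[of "F k z" "G w" "G z"]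
        by (simp add: dist_commute)
    qed
  qed
qed

lemma extension_of_real:
  assumes "extends_by_formula \<psi> \<Psi>" "x \<in> neg_orthant"
  shows "\<Psi> (\<chi> j. complex_of_real (x $ j)) = complex_of_real (\<psi> x)"
proof -
  obtain c0 c1 \<mu> where rep: "represents c0 c1 \<mu> \<psi>"
    and \<Psi>: "\<And>z. z \<in> closure left_tube \<Longrightarrow>
      \<Psi> z = complex_of_real c0 + cdot z c1 + (\<integral>u. (exp (cdot z u) - 1) \<partial>\<mu>)"
    using assms unfolding extends_by_formula_def by blast
  have x_tube: "(\<chi> j. complex_of_real (x $ j)) \<in> left_tube"
    using assms by (auto simp: left_tube_def neg_orthant_def)
  have "\<Psi> (\<chi> j. complex_of_real (x $ j)) = complex_of_real c0 + complex_of_real (x \<bullet> c1) +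
      (\<integral>u. (exp (complex_of_real (x \<bullet> u)) - 1) \<partial>\<mu>)"
    unfolding \<Psi>[OF left_tube_subset_closure[OF x_tube]] cdot_of_real ..
  also have "(\<integral>u. (exp (complex_of_real (x \<bullet> u)) - 1) \<partial>\<mu>) =
      (\<integral>u. complex_of_real (exp (x \<bullet> u) - 1) \<partial>\<mu>)"
    by (simp add: exp_of_real)
  also have "\<dots> = complex_of_real (\<integral>u. exp (x \<bullet> u) - 1 \<partial>\<mu>)"
    by (rule integral_complex_of_real)
  finally show ?thesis
    using rep assms by (simp add: represents_def inner_commute)
qed

text \<open>The complex line through \<open>Re z\<close> in direction \<open>Im z\<close> passes through \<open>z\<close> at the parameter
  \<open>\<i>\<close>, and its real points near \<open>0\<close> lie in the real orthant, where convergence is known.\<close>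

lemma extension_pointwise_limit:
  assumes ext: "\<And>k. extends_by_formula (\<psi>s k) (\<Psi>s k)" "extends_by_formula \<psi> \<Psi>"
    and lim: "\<And>x. x \<in> neg_orthant \<Longrightarrow> (\<lambda>k. \<psi>s k x) \<longlonglongrightarrow> \<psi> x"
    and M: "\<And>k. - \<psi>s k (- 1) \<le> M"
    and z: "z \<in> left_tube"
  shows "(\<lambda>k. \<Psi>s k z) \<longlonglongrightarrow> \<Psi> z"
proof -
  define x :: "real ^ 'a" where "x = (\<chi> j. Re (z $ j))"
  define y :: "real ^ 'a" where "y = (\<chi> j. Im (z $ j))"
  define X :: "complex ^ 'a" where "X = (\<chi> j. complex_of_real (x $ j))"
  define Y :: "complex ^ 'a" where "Y = (\<chi> j. complex_of_real (y $ j))"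
  define L where "L = (\<lambda>\<zeta>. X + \<zeta> *s Y)"
  define S where "S = {\<zeta>. L \<zeta> \<in> left_tube}"
  have S_eq: "S = (\<Inter>j. {\<zeta>. x $ j + Re \<zeta> * y $ j < 0})"
    by (auto simp: S_def L_def X_def Y_def left_tube_def)
  have S_open: "open S"
    unfolding S_eq by (intro open_INT ballI open_Collect_less continuous_intros) simp
  have S_conn: "connected S"
  proof (intro convex_connected)
    have "{\<zeta>. x $ j + Re \<zeta> * y $ j < 0} = {\<zeta>. complex_of_real (y $ j) \<bullet> \<zeta> < - x $ j}" for j
      by (auto simp: inner_complex_def mult.commute)
    then show "convex S"
      unfolding S_eq by (intro convex_INT) (simp add: convex_halfspace_lt)
  qed
  have cont_L: "continuous_on A L" for A
  proof -
    have "continuous_on A (\<lambda>\<zeta>. \<chi> j. X $ j + \<zeta> * Y $ j)"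
      by (intro continuous_on_vec_lambda continuous_intros)
    moreover have "(\<lambda>\<zeta>. \<chi> j. X $ j + \<zeta> * Y $ j) = L"
      by (simp add: L_def vec_eq_iff fun_eq_iff)
    ultimately show ?thesis by (rule back_subst)
  qed
  have hol: "(\<lambda>\<zeta>. \<Phi> (L \<zeta>)) holomorphic_on S" if \<Phi>: "extends_by_formula \<phi> \<Phi>" for \<phi> \<Phi>
  proof (unfold holomorphic_on_open[OF S_open], intro ballI)
    fix \<zeta> assume "\<zeta> \<in> S"
    then obtain D where "((\<lambda>h. \<Phi> (L \<zeta> + h *s Y)) has_field_derivative D) (at 0)"
      using extension_differentiable_along_line[OF \<Phi>, of "L \<zeta>" Y]
      unfolding S_def field_differentiable_def by blast
    moreover have "L \<zeta> + h *s Y = L (h + \<zeta>)" for h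
      by (simp add: L_def vector_sadd_rdistrib algebra_simps)
    ultimately have "((\<lambda>h. \<Phi> (L (h + \<zeta>))) has_field_derivative D) (at 0)"
      by simp
    then show "\<exists>f'. ((\<lambda>\<zeta>. \<Phi> (L \<zeta>)) has_field_derivative f') (at \<zeta>)"
      using DERIV_shift[of "\<lambda>\<zeta>. \<Phi> (L \<zeta>)" D 0 \<zeta>] by auto
  qed
  have bounded: "\<exists>B. \<forall>k. \<forall>\<zeta>\<in>K. norm (\<Psi>s k (L \<zeta>)) \<le> B" if K: "compact K" "K \<subseteq> S" for K
  proof -
    have "bounded (L ` K)"
      using K(1) cont_L by (intro compact_imp_bounded compact_continuous_image)
    then obtain R where R: "0 < R" "\<And>\<zeta>. \<zeta> \<in> K \<Longrightarrow> norm (L \<zeta>) \<le> R"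
      unfolding bounded_pos by auto
    have "norm (\<Psi>s k (L \<zeta>)) \<le> 2 * (2 + R) * M" if "\<zeta> \<in> K" for k \<zeta>
    proof -
      have "norm (\<Psi>s k (L \<zeta>)) \<le> 2 * (2 + R) * (- \<psi>s k (- 1))"
        using that K R by (intro extension_bound[OF ext(1)] left_tube_subset_closure) (auto simp: S_def)
      also have "\<dots> \<le> 2 * (2 + R) * M"
        using R M by (intro mult_left_mono) auto
      finally show ?thesis .
    qed
    then show ?thesis by blast
  qed
  have real_lim: "(\<lambda>k. \<Psi>s k (L \<zeta>)) \<longlonglongrightarrow> \<Psi> (L \<zeta>)" if "\<zeta> \<in> \<real> \<inter> S" for \<zeta>
  proof -
    have "\<zeta> \<in> \<real>" using that by simp
    then obtain t where t: "\<zeta> = complex_of_real t" by (rule Reals_cases)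
    have L: "L \<zeta> = (\<chi> j. complex_of_real ((x + t *\<^sub>R y) $ j))"
      by (simp add: L_def X_def Y_def t vec_eq_iff)
    have n: "x + t *\<^sub>R y \<in> neg_orthant"
      using that by (auto simp: S_eq neg_orthant_def t)
    show ?thesis
      unfolding L extension_of_real[OF ext(1) n] extension_of_real[OF ext(2) n]
      by (intro tendsto_of_real lim n)
  qed
  have 0: "0 \<in> S"
    using z by (simp add: S_eq x_def left_tube_def)
  have islimpt: "0 islimpt (\<real> \<inter> S)"
  proof (rule islimptI)
    fix T :: "complex set" assume T: "0 \<in> T" "open T"
    have "\<exists>r>0. ball 0 r \<subseteq> T \<inter> S"
      by (rule openE[of "T \<inter> S" 0]) (use T 0 S_open in auto)
    then obtain r where r: "0 < r" "ball 0 r \<subseteq> T \<inter> S" by blast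
    have "complex_of_real (r / 2) \<in> ball 0 r" using r by (simp add: dist_norm)
    then show "\<exists>y\<in>\<real> \<inter> S. y \<in> T \<and> y \<noteq> 0"
      using r by (intro bexI[of _ "complex_of_real (r / 2)"]) auto
  qed
  have L_i: "L \<i> = z"
    by (simp add: L_def X_def Y_def x_def y_def vec_eq_iff complex_eq_iff)
  then have i: "\<i> \<in> S" using z by (simp add: S_def)
  have "(\<lambda>k. \<Psi>s k (L \<i>)) \<longlonglongrightarrow> \<Psi> (L \<i>)"
    by (rule Vitali_pointwise[OF S_open S_conn hol[OF ext(1)] hol[OF ext(2)] bounded _ 0 islimpt real_lim i])
       auto
  then show ?thesis by (simp only: L_i)
qed

lemma extension_uniform_limit:
  assumes ext: "\<And>k. extends_by_formula (\<psi>s k) (\<Psi>s k)" "extends_by_formula \<psi> \<Psi>"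
    and lim: "\<And>x. x \<in> neg_orthant \<Longrightarrow> (\<lambda>k. \<psi>s k x) \<longlonglongrightarrow> \<psi> x"
    and M: "\<And>k. - \<psi>s k (- 1) \<le> M"
    and K: "compact K" "K \<subseteq> left_tube"
  shows "uniform_limit K \<Psi>s \<Psi> sequentially"
proof (cases "K = {}")
  case False
  have "\<exists>a<0. \<forall>z\<in>K. Re (z $ j) \<le> a" for j
  proof -
    have "continuous_on K (\<lambda>z. Re (z $ j))" by (intro continuous_intros)
    then obtain z where "z \<in> K" "\<And>w. w \<in> K \<Longrightarrow> Re (w $ j) \<le> Re (z $ j)"
      using continuous_attains_sup[OF K(1) False] by metis
    then show ?thesis
      using K(2) by (intro exI[of _ "Re (z $ j)"]) (auto simp: left_tube_def)
  qed
  then obtain a where a: "\<And>j. a j < 0" "\<And>j z. z \<in> K \<Longrightarrow> Re (z $ j) \<le> a j"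
    by metis
  define e where "e = Min (range (\<lambda>j. - a j))"
  have e: "0 < e" using a by (simp add: e_def)
  have "e \<le> - a j" for j unfolding e_def by (rule Min_le) auto
  then have Re: "Re (z $ j) \<le> - e" if "z \<in> K" for z j
    using a(2)[OF that, of j] by (smt (verit))
  show ?thesis
  proof (rule uniform_limit_equi_Lipschitz[OF K(1)])
    show "(\<lambda>k. \<Psi>s k z) \<longlonglongrightarrow> \<Psi> z" if "z \<in> K" for z
      using that K(2) by (intro extension_pointwise_limit[OF ext lim M]) auto
    show "dist (\<Psi>s k z) (\<Psi>s k w) \<le> (2 * (1 + 1 / e) * M) * dist z w" if "z \<in> K" "w \<in> K" for k z w
    proof -
      have "norm (\<Psi>s k z - \<Psi>s k w) \<le> 2 * (1 + 1 / e) * (- \<psi>s k (- 1)) * norm (z - w)"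
        by (rule extension_Lipschitz[OF ext(1) e Re[OF that(1)] Re[OF that(2)]])
      also have "\<dots> \<le> 2 * (1 + 1 / e) * M * norm (z - w)"
        using M e by (intro mult_right_mono mult_left_mono) auto
      finally show ?thesis by (simp add: dist_norm)
    qed
  qed
qed auto

section \<open>The pointwise limit belongs to the class\<close>

lemma partial_derivs_append: "partial_derivs (xs @ ys) f = partial_derivs xs (partial_derivs ys f)"
  by (induction xs) auto

lemma class_T_iff:
  "\<psi> \<in> class_T \<longleftrightarrow> C_infinity_on neg_orthant \<psi> \<and> (\<forall>x\<in>neg_orthant. \<psi> x \<le> 0) \<and>
     (\<forall>js. js \<noteq> [] \<longrightarrow> (\<forall>x\<in>neg_orthant. 0 \<le> partial_derivs js \<psi> x))"
proof -
  have *: "partial_derivs js (partial_deriv j \<psi>) = partial_derivs (js @ [j]) \<psi>" for js j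
    by (simp add: partial_derivs_append)
  have "C_infinity_on neg_orthant (partial_deriv j \<psi>)" if "C_infinity_on neg_orthant \<psi>" for j
    using that unfolding C_infinity_on_def * by blast
  moreover have "(\<forall>js. js \<noteq> [] \<longrightarrow> (\<forall>x\<in>neg_orthant. 0 \<le> partial_derivs js \<psi> x)) \<longleftrightarrow>
      (\<forall>j js. \<forall>x\<in>neg_orthant. 0 \<le> partial_derivs (js @ [j]) \<psi> x)"
    by (metis append_is_Nil_conv list.distinct(1) rev_exhaust)
  ultimately show ?thesis
    unfolding class_T_def absolutely_monotone_def * mem_Collect_eq by blast
qed

lemma partial_deriv_along_line:
  assumes "(\<lambda>s. g ((x + t *\<^sub>R axis j 1) + s *\<^sub>R axis j 1)) field_differentiable (at 0)"
  shows "((\<lambda>s. g (x + s *\<^sub>R axis j 1)) has_real_derivative partial_deriv j g (x + t *\<^sub>R axis j 1)) (at t)"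
proof -
  have "((\<lambda>s. g ((x + t *\<^sub>R axis j 1) + s *\<^sub>R axis j 1)) has_real_derivative
      partial_deriv j g (x + t *\<^sub>R axis j 1)) (at 0)"
    using assms unfolding partial_deriv_def by (simp add: DERIV_deriv_iff_field_differentiable)
  moreover have "(x + t *\<^sub>R axis j 1) + s *\<^sub>R axis j 1 = x + (s + t) *\<^sub>R axis j 1" for s
    by (simp add: algebra_simps)
  ultimately show ?thesis
    using DERIV_shift[of "\<lambda>s. g (x + s *\<^sub>R axis j 1)" _ 0 t] by simp
qed

lemma neg_orthant_line:
  assumes "x \<in> neg_orthant" "t < - x $ j"
  shows "x + t *\<^sub>R axis j 1 \<in> neg_orthant"
  using assms by (auto simp: neg_orthant_def axis_def)

subsection \<open>Convergence of derivatives\<close>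

text \<open>A uniform bound on the second derivatives makes the difference quotients approximate the
  derivatives uniformly in \<open>k\<close>, so that the limit in \<open>k\<close> and the derivative can be exchanged.\<close>

lemma derivative_of_pointwise_limit:
  fixes f f1 f2 :: "nat \<Rightarrow> real \<Rightarrow> real"
  assumes r: "0 < r"
    and f1: "\<And>k t. \<bar>t\<bar> < r \<Longrightarrow> (f k has_real_derivative f1 k t) (at t)"
    and f2: "\<And>k t. \<bar>t\<bar> < r \<Longrightarrow> (f1 k has_real_derivative f2 k t) (at t)"
    and M: "\<And>k t. \<bar>t\<bar> < r \<Longrightarrow> \<bar>f2 k t\<bar> \<le> M"
    and lim: "\<And>t. \<bar>t\<bar> < r \<Longrightarrow> (\<lambda>k. f k t) \<longlonglongrightarrow> g t"
  obtains l where "(\<lambda>k. f1 k 0) \<longlonglongrightarrow> l" "(g has_real_derivative l) (at 0)"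
proof -
  have M0: "0 \<le> M" using M[of 0] r by fastforce
  have quot: "\<bar>(f k h - f k 0) / h - f1 k 0\<bar> \<le> M * \<bar>h\<bar>" if h: "h \<noteq> 0" "\<bar>h\<bar> < r" for k h
  proof -
    have f1_diff: "norm (f1 k t - f1 k 0) \<le> M * \<bar>h\<bar>" if t: "t \<in> cball 0 \<bar>h\<bar>" for t
    proof -
      have "norm (f1 k t - f1 k 0) \<le> M * norm (t - 0)"
      proof (rule field_differentiable_bound[where S = "cball 0 \<bar>h\<bar>" and f' = "f2 k"])
        show "(f1 k has_real_derivative f2 k s) (at s within cball 0 \<bar>h\<bar>)" if "s \<in> cball 0 \<bar>h\<bar>" for s
          using that h by (intro has_field_derivative_at_within[OF f2]) (auto simp: dist_norm)
        show "norm (f2 k s) \<le> M" if "s \<in> cball 0 \<bar>h\<bar>" for s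
          using that h M[of s] by (auto simp: dist_norm)
      qed (use t in auto)
      also have "\<dots> \<le> M * \<bar>h\<bar>"
        using t M0 by (intro mult_left_mono) (auto simp: dist_norm)
      finally show ?thesis .
    qed
    have "norm ((f k h - h * f1 k 0) - (f k 0 - 0 * f1 k 0)) \<le> (M * \<bar>h\<bar>) * norm (h - 0)"
    proof (rule field_differentiable_bound[where S = "cball 0 \<bar>h\<bar>" and f' = "\<lambda>t. f1 k t - f1 k 0"
          and f = "\<lambda>t. f k t - t * f1 k 0"])
      show "((\<lambda>t. f k t - t * f1 k 0) has_real_derivative f1 k s - f1 k 0) (at s within cball 0 \<bar>h\<bar>)"
        if "s \<in> cball 0 \<bar>h\<bar>" for s
        using that h by (auto intro!: derivative_eq_intros has_field_derivative_at_within[OF f1])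
    qed (use f1_diff in auto)
    then have "\<bar>f k h - h * f1 k 0 - f k 0\<bar> / \<bar>h\<bar> \<le> M * \<bar>h\<bar>"
      using h by (simp add: pos_divide_le_eq)
    also have "\<bar>f k h - h * f1 k 0 - f k 0\<bar> / \<bar>h\<bar> = \<bar>(f k h - f k 0) / h - f1 k 0\<bar>"
      unfolding abs_divide[symmetric] using h by (simp add: diff_divide_distrib)
    finally show ?thesis .
  qed
  have q_lim: "(\<lambda>k. (f k h - f k 0) / h) \<longlonglongrightarrow> (g h - g 0) / h" if "h \<noteq> 0" "\<bar>h\<bar> < r" for h
    using that r by (intro tendsto_intros lim) auto
  have "Cauchy (\<lambda>k. f1 k 0)"
  proof (rule metric_CauchyI)
    fix e :: real assume e: "0 < e"
    define h where "h = min (r / 2) (e / (4 * (M + 1)))"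
    have h: "0 < h" "h < r" using r e M0 by (auto simp: h_def)
    have "M * h \<le> M * (e / (4 * (M + 1)))"
      using M0 by (intro mult_left_mono) (auto simp: h_def)
    also have "\<dots> < e / 3"
      using M0 e by (simp add: field_simps add_nonneg_pos)
    finally have Mh: "M * h < e / 3" .
    have "Cauchy (\<lambda>k. (f k h - f k 0) / h)"
      using q_lim[of h] h by (intro LIMSEQ_imp_Cauchy) auto
    from metric_CauchyD[OF this, of "e / 3"] e
    obtain N where N: "\<And>m n. N \<le> m \<Longrightarrow> N \<le> n \<Longrightarrow>
        dist ((f m h - f m 0) / h) ((f n h - f n 0) / h) < e / 3"
      by auto
    have "dist (f1 m 0) (f1 n 0) < e" if "N \<le> m" "N \<le> n" for m n
    proof -
      have "\<bar>(f k h - f k 0) / h - f1 k 0\<bar> < e / 3" for k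
        using quot[of h k] h Mh by simp
      from N[OF that] this[of m] this[of n] show ?thesis
        unfolding dist_real_def by linarith
    qed
    then show "\<exists>N. \<forall>m\<ge>N. \<forall>n\<ge>N. dist (f1 m 0) (f1 n 0) < e" by blast
  qed
  then obtain l where l: "(\<lambda>k. f1 k 0) \<longlonglongrightarrow> l"
    using Cauchy_convergent convergent_def by blast
  have "(g has_real_derivative l) (at 0)"
    unfolding has_field_derivative_iff
  proof (rule LIM_zero_cancel, rule Lim_null_comparison)
    have "\<forall>\<^sub>F h in at 0. \<bar>h\<bar> < r \<and> h \<noteq> 0"
      using r by (auto simp: eventually_at dist_norm)
    then show "\<forall>\<^sub>F h in at 0. norm ((g h - g 0) / (h - 0) - l) \<le> M * \<bar>h\<bar>"
    proof eventually_elim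
      case (elim h)
      have "(\<lambda>k. \<bar>(f k h - f k 0) / h - f1 k 0\<bar>) \<longlonglongrightarrow> \<bar>(g h - g 0) / h - l\<bar>"
        using elim by (intro tendsto_intros q_lim l) auto
      then have "\<bar>(g h - g 0) / h - l\<bar> \<le> M * \<bar>h\<bar>"
        by (rule LIMSEQ_le_const2) (use quot elim in auto)
      then show ?case by simp
    qed
    show "((\<lambda>h. M * \<bar>h\<bar>) \<longlongrightarrow> 0) (at 0)"
      by (auto intro!: tendsto_eq_intros)
  qed
  with l that show ?thesis by blast
qed

text \<open>Since the first three derivatives are nonnegative, \<open>f2\<close> and \<open>f1\<close> are increasing and
  can be compared with difference quotients taken further to the right.\<close>

lemma second_derivative_bound:
  fixes f :: "real \<Rightarrow> real"
  assumes r: "0 < r"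
    and f1: "\<And>t. t < 4 * r \<Longrightarrow> (f has_real_derivative f1 t) (at t)"
    and f2: "\<And>t. t < 4 * r \<Longrightarrow> (f1 has_real_derivative f2 t) (at t)"
    and f3: "\<And>t. t < 4 * r \<Longrightarrow> (f2 has_real_derivative f3 t) (at t)"
    and nonneg: "\<And>t. t < 4 * r \<Longrightarrow> 0 \<le> f1 t" "\<And>t. t < 4 * r \<Longrightarrow> 0 \<le> f2 t" "\<And>t. t < 4 * r \<Longrightarrow> 0 \<le> f3 t"
    and t: "t < r"
  shows "f2 t \<le> (f (3 * r) - f (2 * r)) / r\<^sup>2"
proof -
  obtain \<xi> where \<xi>: "r < \<xi>" "\<xi> < 2 * r" "f1 (2 * r) - f1 r = (2 * r - r) * f2 \<xi>"
    using MVT2[of r "2 * r" f1 f2] f2 r by force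
  obtain \<zeta> where \<zeta>: "2 * r < \<zeta>" "\<zeta> < 3 * r" "f (3 * r) - f (2 * r) = (3 * r - 2 * r) * f1 \<zeta>"
    using MVT2[of "2 * r" "3 * r" f f1] f1 r by force
  have "f2 t \<le> f2 \<xi>"
  proof (rule DERIV_nonneg_imp_nondecreasing[where f = f2])
    show "t \<le> \<xi>" using t \<xi> by simp
    show "\<exists>d. (f2 has_real_derivative d) (at s) \<and> 0 \<le> d" if "s \<le> \<xi>" for s
      using f3[of s] nonneg(3)[of s] that \<xi> r by fastforce
  qed
  then have "r * f2 t \<le> r * f2 \<xi>" using r by simp
  also have "\<dots> = f1 (2 * r) - f1 r" using \<xi> by simp
  also have "\<dots> \<le> f1 (2 * r)" using nonneg(1)[of r] r by simp
  also have "\<dots> \<le> f1 \<zeta>"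
  proof (rule DERIV_nonneg_imp_nondecreasing[where f = f1])
    show "2 * r \<le> \<zeta>" using \<zeta> by simp
    show "\<exists>d. (f1 has_real_derivative d) (at s) \<and> 0 \<le> d" if "s \<le> \<zeta>" for s
      using f2[of s] nonneg(2)[of s] that \<zeta> r by fastforce
  qed
  finally have "r * (r * f2 t) \<le> r * f1 \<zeta>" using r by simp
  also have "\<dots> = f (3 * r) - f (2 * r)" using \<zeta> by simp
  finally show ?thesis
    using r by (simp add: field_simps power2_eq_square)
qed

lemma partial_deriv_limit_step:
  assumes T: "\<And>k. \<psi>s k \<in> class_T"
    and lim: "\<And>x. x \<in> neg_orthant \<Longrightarrow> (\<lambda>k. partial_derivs js (\<psi>s k) x) \<longlonglongrightarrow> partial_derivs js \<psi> x"
    and x: "x \<in> neg_orthant"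
  obtains l where "(\<lambda>k. partial_derivs (j # js) (\<psi>s k) x) \<longlonglongrightarrow> l"
    and "((\<lambda>t. partial_derivs js \<psi> (x + t *\<^sub>R axis j 1)) has_real_derivative l) (at 0)"
proof -
  define r where "r = - x $ j / 4"
  have r: "0 < r" using x by (simp add: r_def neg_orthant_def)
  define p where "p = (\<lambda>is k t. partial_derivs is (\<psi>s k) (x + t *\<^sub>R axis j 1))"
  have line: "x + t *\<^sub>R axis j 1 \<in> neg_orthant" if "t < 4 * r" for t
    using that x by (intro neg_orthant_line) (auto simp: r_def)
  have deriv: "(p is k has_real_derivative p (j # is) k t) (at t)" if "t < 4 * r" for "is" k t
    unfolding p_def partial_derivs.simps
    by (rule partial_deriv_along_line) (use T line[OF that] in \<open>auto simp: class_T_iff C_infinity_on_def\<close>)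
  have nonneg: "0 \<le> p (i # is) k t" if "t < 4 * r" for i "is" k t
    using T[of k] line[OF that] by (auto simp: p_def class_T_iff simp del: partial_derivs.simps)
  have p_lim: "(\<lambda>k. p js k t) \<longlonglongrightarrow> partial_derivs js \<psi> (x + t *\<^sub>R axis j 1)" if "t < 4 * r" for t
    unfolding p_def by (rule lim[OF line[OF that]])
  have "(\<lambda>k. (p js k (3 * r) - p js k (2 * r)) / r\<^sup>2) \<longlonglongrightarrow>
      (partial_derivs js \<psi> (x + (3 * r) *\<^sub>R axis j 1) - partial_derivs js \<psi> (x + (2 * r) *\<^sub>R axis j 1)) / r\<^sup>2"
    using r by (intro tendsto_intros p_lim) auto
  then have "Bseq (\<lambda>k. (p js k (3 * r) - p js k (2 * r)) / r\<^sup>2)"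
    by (intro convergent_imp_Bseq convergentI)
  then obtain M where M: "\<And>k. \<bar>(p js k (3 * r) - p js k (2 * r)) / r\<^sup>2\<bar> \<le> M"
    unfolding Bseq_def by auto
  have bound: "\<bar>p (j # j # js) k t\<bar> \<le> M" if "\<bar>t\<bar> < r" for k t
  proof -
    have "p (j # j # js) k t \<le> (p js k (3 * r) - p js k (2 * r)) / r\<^sup>2"
      by (rule second_derivative_bound[OF r deriv deriv deriv nonneg nonneg nonneg]) (use that in auto)
    then show ?thesis
      using M[of k] nonneg[of t] that r by (smt (verit))
  qed
  show ?thesis
  proof (rule derivative_of_pointwise_limit[of r "p js" "p (j # js)" "p (j # j # js)" M
        "\<lambda>t. partial_derivs js \<psi> (x + t *\<^sub>R axis j 1)"])
    fix l assume "(\<lambda>k. p (j # js) k 0) \<longlonglongrightarrow> l"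
      "((\<lambda>t. partial_derivs js \<psi> (x + t *\<^sub>R axis j 1)) has_real_derivative l) (at 0)"
    then show thesis
      by (intro that) (auto simp: p_def)
  qed (use r deriv p_lim bound in auto)
qed

lemma partial_derivs_limit:
  assumes T: "\<And>k. \<psi>s k \<in> class_T"
    and lim: "\<And>x. x \<in> neg_orthant \<Longrightarrow> (\<lambda>k. \<psi>s k x) \<longlonglongrightarrow> \<psi> x"
    and x: "x \<in> neg_orthant"
  shows "(\<lambda>k. partial_derivs js (\<psi>s k) x) \<longlonglongrightarrow> partial_derivs js \<psi> x"
  using x
proof (induction js arbitrary: x)
  case Nil
  then show ?case using lim by simp
next
  case (Cons j js)
  obtain l where l: "(\<lambda>k. partial_derivs (j # js) (\<psi>s k) x) \<longlonglongrightarrow> l"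
    and d: "((\<lambda>t. partial_derivs js \<psi> (x + t *\<^sub>R axis j 1)) has_real_derivative l) (at 0)"
    using partial_deriv_limit_step[OF T Cons.IH Cons.prems] by blast
  have "partial_derivs (j # js) \<psi> x = l"
    using DERIV_imp_deriv[OF d] by (simp add: partial_deriv_def)
  then show ?case using l by simp
qed

subsection \<open>Continuity from monotone partial derivatives\<close>

text \<open>Passing from \<open>x\<close> to \<open>y\<close> one coordinate at a time reduces this to one variable.  The bound
  \<open>b\<close> is needed because the comparison in the continuity proof uses partial derivatives bounded
  from above, which they are only below a fixed point of the orthant.\<close>

lemma coordinatewise_mono:
  fixes g :: "real ^ 'n \<Rightarrow> real"
  assumes der: "\<And>x j. (\<And>i. x $ i < b $ i) \<Longrightarrow>
      \<exists>d\<ge>0. ((\<lambda>t. g (x + t *\<^sub>R axis j 1)) has_real_derivative d) (at 0)"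
    and xy: "\<And>i. x $ i \<le> y $ i" and y: "\<And>i. y $ i < b $ i"
  shows "g x \<le> g y"
proof -
  define m where "m = (\<lambda>S. \<chi> i. if i \<in> S then y $ i else x $ i)"
  have "g x \<le> g (m S)" if "finite S" for S
    using that
  proof induction
    case empty
    have "m {} = x" by (simp add: m_def vec_eq_iff)
    then show ?case by simp
  next
    case (insert j S)
    have eq: "m (insert j S) = m S + (y $ j - x $ j) *\<^sub>R axis j 1"
      using insert by (auto simp: m_def vec_eq_iff axis_def)
    have "g (m S + 0 *\<^sub>R axis j 1) \<le> g (m S + (y $ j - x $ j) *\<^sub>R axis j 1)"
    proof (rule DERIV_nonneg_imp_nondecreasing[where f = "\<lambda>s. g (m S + s *\<^sub>R axis j 1)"])
      show "0 \<le> y $ j - x $ j" using xy by simp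
      fix t assume t: "0 \<le> t" "t \<le> y $ j - x $ j"
      have xb: "x $ i < b $ i" for i using xy[of i] y[of i] by linarith
      have "(m S + t *\<^sub>R axis j 1) $ i < b $ i" for i
        using t y[of i] xb[of i] insert by (cases "i = j") (auto simp: m_def axis_def)
      then obtain d where "0 \<le> d"
        "((\<lambda>s. g ((m S + t *\<^sub>R axis j 1) + s *\<^sub>R axis j 1)) has_real_derivative d) (at 0)"
        using der by blast
      moreover have "(m S + t *\<^sub>R axis j 1) + s *\<^sub>R axis j 1 = m S + (s + t) *\<^sub>R axis j 1" for s
        by (simp add: algebra_simps)
      ultimately show "\<exists>d. ((\<lambda>s. g (m S + s *\<^sub>R axis j 1)) has_real_derivative d) (at t) \<and> 0 \<le> d"
        using DERIV_shift[of "\<lambda>s. g (m S + s *\<^sub>R axis j 1)" d 0 t] by auto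
    qed
    then show ?case using insert eq by simp
  qed
  moreover have "m UNIV = y" by (simp add: m_def vec_eq_iff)
  ultimately show ?thesis by (metis finite_class.finite_UNIV)
qed

text \<open>Near \<open>x\<close> the values of \<open>g\<close> are squeezed between those at the two corners \<open>x - h\<close> and
  \<open>x + h\<close> of a small cube; these differ by \<open>O(h)\<close>, since the partial derivatives are bounded on
  the orthant below a fixed point.\<close>

lemma continuous_on_neg_orthant_if_partials_mono:
  fixes g :: "real ^ 'n \<Rightarrow> real"
  assumes der: "\<And>x j. x \<in> neg_orthant \<Longrightarrow>
      ((\<lambda>t. g (x + t *\<^sub>R axis j 1)) has_real_derivative D j x) (at 0)"
    and nonneg: "\<And>x j. x \<in> neg_orthant \<Longrightarrow> 0 \<le> D j x"
    and mono: "\<And>x y j. y \<in> neg_orthant \<Longrightarrow> (\<And>i. x $ i \<le> y $ i) \<Longrightarrow> D j x \<le> D j y"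
  shows "continuous_on neg_orthant g"
proof (intro continuous_at_imp_continuous_on ballI)
  fix x :: "real ^ 'n" assume x: "x \<in> neg_orthant"
  define b where "b = (\<chi> i. x $ i / 2)"
  have b: "b \<in> neg_orthant" "x $ i < b $ i" for i
    using x by (auto simp: b_def neg_orthant_def)
  have below_b: "y \<in> neg_orthant" if "\<And>i. y $ i < b $ i" for y
    using that b(1) unfolding neg_orthant_def by (smt (verit) mem_Collect_eq)
  define M where "M = (\<Sum>j\<in>UNIV. D j b)"
  have M: "D j y \<le> M" if "\<And>i. y $ i < b $ i" for j y
  proof -
    have "D j y \<le> D j b" using that b by (intro mono) (auto intro: less_imp_le)
    also have "\<dots> \<le> M" unfolding M_def by (rule member_le_sum) (use nonneg b in auto)
    finally show ?thesis .
  qed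
  have g_mono: "g u \<le> g v" if "\<And>i. u $ i \<le> v $ i" "\<And>i. v $ i < b $ i" for u v
    by (rule coordinatewise_mono[where b = b]) (use that der nonneg below_b in blast)+
  have g_upper: "g v - g u \<le> M * (\<Sum>i\<in>UNIV. v $ i - u $ i)"
    if "\<And>i. u $ i \<le> v $ i" "\<And>i. v $ i < b $ i" for u v
  proof -
    have "M * (\<Sum>i\<in>UNIV. u $ i) - g u \<le> M * (\<Sum>i\<in>UNIV. v $ i) - g v"
    proof (rule coordinatewise_mono[where b = b])
      fix y :: "real ^ 'n" and j assume y: "\<And>i. y $ i < b $ i"
      have sum: "(\<Sum>i\<in>UNIV. (y + t *\<^sub>R axis j 1) $ i) = (\<Sum>i\<in>UNIV. y $ i) + t" for t
      proof -
        have "(y + t *\<^sub>R axis j 1) $ i = y $ i + (if i = j then t else 0)" for i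
          by (simp add: axis_def)
        then show ?thesis by (simp only: sum.distrib sum.delta finite_class.finite_UNIV UNIV_I if_True)
      qed
      have "((\<lambda>t. M * (\<Sum>i\<in>UNIV. (y + t *\<^sub>R axis j 1) $ i) - g (y + t *\<^sub>R axis j 1))
          has_real_derivative M - D j y) (at 0)"
        unfolding sum by (auto intro!: derivative_eq_intros der[OF below_b[OF y]])
      then show "\<exists>d\<ge>0. ((\<lambda>t. M * (\<Sum>i\<in>UNIV. (y + t *\<^sub>R axis j 1) $ i) - g (y + t *\<^sub>R axis j 1))
          has_real_derivative d) (at 0)"
        using M[OF y, of j] by (intro exI[of _ "M - D j y"]) auto
    qed (use that in auto)
    then show ?thesis by (simp add: sum_subtractf right_diff_distrib)
  qed
  define \<eta> where "\<eta> = Min (range (\<lambda>i. b $ i - x $ i))"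
  have \<eta>: "0 < \<eta>" using b(2) by (simp add: \<eta>_def)
  have \<eta>_le: "\<eta> \<le> b $ i - x $ i" for i unfolding \<eta>_def by (rule Min_le) auto
  have close: "\<bar>g y - g x\<bar> \<le> M * (real CARD('n) * (2 * norm (y - x)))" if y: "norm (y - x) < \<eta>" for y
  proof -
    define h where "h = norm (y - x)"
    define u where "u = (\<chi> i. x $ i - h)"
    define v where "v = (\<chi> i. x $ i + h)"
    have yx: "\<bar>y $ i - x $ i\<bar> \<le> h" for i
      using component_le_norm_cart[of "y - x" i] by (simp add: h_def)
    have h: "0 \<le> h" "x $ i + h < b $ i" for i
      using y \<eta>_le[of i] by (auto simp: h_def)
    have "g u \<le> g y" "g u \<le> g x" "g y \<le> g v" "g x \<le> g v"
      using h yx by (auto intro!: g_mono simp: u_def v_def abs_le_iff)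
        (smt (verit))+
    moreover have "g v - g u \<le> M * (\<Sum>i\<in>UNIV. v $ i - u $ i)"
      using h by (intro g_upper) (auto simp: u_def v_def)
    ultimately show ?thesis
      by (simp add: u_def v_def h_def[symmetric])
  qed
  show "isCont g x"
    unfolding isCont_def
  proof (rule LIM_zero_cancel, rule Lim_null_comparison)
    show "\<forall>\<^sub>F y in at x. norm (g y - g x) \<le> M * (real CARD('n) * (2 * norm (y - x)))"
      using \<eta> close by (auto simp: eventually_at dist_norm)
    have "((\<lambda>y. M * (real CARD('n) * (2 * norm (y - x)))) \<longlongrightarrow>
        M * (real CARD('n) * (2 * norm (x - x)))) (at x)"
      by (intro tendsto_intros)
    then show "((\<lambda>y. M * (real CARD('n) * (2 * norm (y - x)))) \<longlongrightarrow> 0) (at x)" by simp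
  qed
qed

lemma class_T_closed_under_limits:
  fixes \<psi> :: "real ^ 'n \<Rightarrow> real"
  assumes T: "\<And>k. \<psi>s k \<in> class_T"
    and lim: "\<And>x. x \<in> neg_orthant \<Longrightarrow> (\<lambda>k. \<psi>s k x) \<longlonglongrightarrow> \<psi> x"
  shows "\<psi> \<in> class_T"
proof -
  have deriv: "((\<lambda>t. partial_derivs js \<psi> (x + t *\<^sub>R axis j 1)) has_real_derivative
      partial_derivs (j # js) \<psi> x) (at 0)" if "x \<in> neg_orthant" for js j x
  proof -
    obtain l where l: "((\<lambda>t. partial_derivs js \<psi> (x + t *\<^sub>R axis j 1)) has_real_derivative l) (at 0)"
    proof (rule partial_deriv_limit_step[of \<psi>s js \<psi> x j])
      show "(\<lambda>k. partial_derivs js (\<psi>s k) y) \<longlonglongrightarrow> partial_derivs js \<psi> y" if "y \<in> neg_orthant" for y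
        by (rule partial_derivs_limit[OF T lim that])
    qed (use T \<open>x \<in> neg_orthant\<close> in auto)
    show ?thesis
      using l DERIV_imp_deriv[OF l] by (simp add: partial_deriv_def)
  qed
  have nonneg: "0 \<le> partial_derivs (j # js) \<psi> x" if "x \<in> neg_orthant" for j js x
    by (rule LIMSEQ_le_const[OF partial_derivs_limit[OF T lim that]])
       (use T that in \<open>auto simp: class_T_iff simp del: partial_derivs.simps\<close>)
  have mono: "partial_derivs (j # js) \<psi> x \<le> partial_derivs (j # js) \<psi> y"
    if "y \<in> neg_orthant" "\<And>i. x $ i \<le> y $ i" for j js x y
  proof (rule coordinatewise_mono[where b = 0])
    fix z :: "real ^ 'n" and i assume "\<And>i. z $ i < 0 $ i"
    then have "z \<in> neg_orthant" by (simp add: neg_orthant_def)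
    then show "\<exists>d\<ge>0. ((\<lambda>t. partial_derivs (j # js) \<psi> (z + t *\<^sub>R axis i 1)) has_real_derivative d) (at 0)"
      using deriv nonneg by blast
  qed (use that in \<open>auto simp: neg_orthant_def\<close>)
  have "C_infinity_on neg_orthant \<psi>"
    unfolding C_infinity_on_def
  proof (intro allI conjI ballI)
    show "continuous_on neg_orthant (partial_derivs js \<psi>)" for js
      by (rule continuous_on_neg_orthant_if_partials_mono[OF deriv nonneg mono])
    show "(\<lambda>t. partial_derivs js \<psi> (x + t *\<^sub>R axis j 1)) field_differentiable at 0"
      if "x \<in> neg_orthant" for js j x
      using deriv[OF that] unfolding field_differentiable_def by blast
  qed
  moreover have "\<psi> x \<le> 0" if "x \<in> neg_orthant" for x
    by (rule LIMSEQ_le_const2[OF lim[OF that]]) (use T that in \<open>auto simp: class_T_def\<close>)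
  moreover have "0 \<le> partial_derivs js \<psi> x" if "js \<noteq> []" "x \<in> neg_orthant" for js x
    using that nonneg by (cases js) auto
  ultimately show ?thesis
    unfolding class_T_iff by blast
qed

section \<open>The theorem\<close>

theorem mainTheorem3:
  fixes \<psi>s :: "nat \<Rightarrow> real ^ 'n \<Rightarrow> real" and \<psi> :: "real ^ 'n \<Rightarrow> real"
  assumes "\<And>k. \<psi>s k \<in> class_T"
    and "\<And>x. x \<in> neg_orthant \<Longrightarrow> (\<lambda>k. \<psi>s k x) \<longlonglongrightarrow> \<psi> x"
  shows "\<psi> \<in> class_T \<and>
    (\<forall>\<Psi>s \<Psi>. (\<forall>k. extends_by_formula (\<psi>s k) (\<Psi>s k)) \<and> extends_by_formula \<psi> \<Psi> \<longrightarrow>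
       (\<forall>K. compact K \<and> K \<subseteq> left_tube \<longrightarrow> uniform_limit K \<Psi>s \<Psi> sequentially)) \<and>
    (\<forall>\<Psi>s. (\<forall>k. extends_by_formula (\<psi>s k) (\<Psi>s k)) \<longrightarrow>
       (\<forall>\<theta>. 0 < \<theta> \<and> \<theta> < pi \<longrightarrow>
          (\<forall>K. compact K \<and> K \<subseteq> sector_power \<theta> \<longrightarrow>
             (\<exists>M. \<forall>k. \<forall>z\<in>K. norm (\<Psi>s k z) \<le> M))))"
proof -
  have "(\<lambda>k. \<psi>s k (- 1)) \<longlonglongrightarrow> \<psi> (- 1)"
    by (rule assms(2)[OF neg_1_in_neg_orthant])
  then have "Bseq (\<lambda>k. \<psi>s k (- 1))"
    by (intro convergent_imp_Bseq convergentI)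
  then obtain M where M: "0 < M" "\<And>k. norm (\<psi>s k (- 1)) \<le> M"
    unfolding Bseq_def by blast
  have M': "- \<psi>s k (- 1) \<le> M" for k
    using M(2)[of k] by simp
  have 1: "\<psi> \<in> class_T"
    by (rule class_T_closed_under_limits[OF assms])
  have 2: "uniform_limit K \<Psi>s \<Psi> sequentially"
    if "\<forall>k. extends_by_formula (\<psi>s k) (\<Psi>s k)" "extends_by_formula \<psi> \<Psi>" "compact K" "K \<subseteq> left_tube"
    for \<Psi>s \<Psi> K
    using that by (intro extension_uniform_limit[where \<psi>s = \<psi>s and M = M, OF _ _ assms(2) M']) auto
  have 3: "\<exists>B. \<forall>k. \<forall>z\<in>K. norm (\<Psi>s k z) \<le> B"
    if ext: "\<forall>k. extends_by_formula (\<psi>s k) (\<Psi>s k)" and \<theta>: "0 < \<theta>"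
      and K: "compact K" "K \<subseteq> sector_power \<theta>"
    for \<Psi>s \<theta> K
  proof -
    obtain R where R: "0 < R" "\<And>z. z \<in> K \<Longrightarrow> norm z \<le> R"
      using compact_imp_bounded[OF K(1)] unfolding bounded_pos by blast
    have "norm (\<Psi>s k z) \<le> 2 * (2 + R) * M" if z: "z \<in> K" for k z
    proof -
      have "norm (\<Psi>s k z) \<le> 2 * (2 + R) * (- \<psi>s k (- 1))"
      proof (rule extension_bound)
        show "z \<in> closure left_tube"
          using sector_power_subset[OF \<theta>] K(2) z by blast
      qed (use ext R z in auto)
      also have "\<dots> \<le> 2 * (2 + R) * M"
        using R M' by (intro mult_left_mono) auto
      finally show ?thesis .
    qed
    then show ?thesis by blast
  qed
  show ?thesis
    using 1 2 3 by blast
qed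

end
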